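(* Let $T=\begin{pmatrix}A&B\\ C&D\end{pmatrix}:\mathfrak H\oplus\mathfrak M\to\mathfrak H\oplus\mathfrak N$ be a contraction. Suppose that $$\left(D_T^2\right)_{\mathfrak H}=0\quad\text{and}\quad \mathrm{ran}\left(\left(D^2_{P_{\mathfrak N}T}\right)_{\mathfrak H}\right)^{1/2}\cap\mathrm{ran}\left(\left(D^2_{P_{\mathfrak M}T^*}\right)_{\mathfrak H}\right)^{1/2}\subset\mathrm{ran}\left(\left(D^2_{T^*}\right)_{\mathfrak H}\right)^{1/2}.$$ Then the Riccati equation $$(I_{\mathfrak H}-X)P_{\mathfrak H}=\left(D_T^2+T^*(I_{\mathfrak H}-X)P'_{\mathfrak H}T\right)_{\mathfrak H},\qquad 0<X\le I_{\mathfrak H},$$ has a unique solution $X=I_{\mathfrak H}$.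
   Context: Hilbert spaces are complex and separable. For a contraction $T$, $D_T=(I-T^*T)^{1/2}$. $P_{\mathfrak H},P_{\mathfrak M}$ are the orthogonal projections onto $\mathfrak H,\mathfrak M$ in $\mathfrak H\oplus\mathfrak M$; $P'_{\mathfrak H},P_{\mathfrak N}$ are those onto $\mathfrak H,\mathfrak N$ in $\mathfrak H\oplus\mathfrak N$. So $D^2_{P_{\mathfrak N}T}=I-T^*P_{\mathfrak N}T$ acts in $\mathfrak H\oplus\mathfrak M$ and $D^2_{P_{\mathfrak M}T^*}=I-TP_{\mathfrak M}T^*$ acts in $\mathfrak H\oplus\mathfrak N$. Shorted operator: for bounded $S\ge0$ in $\mathcal H$ and a closed subspace $\mathcal K$, $S_{\mathcal K}=\max\{Z:\ 0\le Z\le S,\ \mathrm{ran}\,Z\subseteq\mathcal K\}$. Shorted operators to $\mathfrak H$ have ranges (and their square roots have ranges) in $\mathfrak H$, and the ranges above are regarded as linear manifolds of the same space $\mathfrak H$. $0<X\le I_{\mathfrak H}$ means a nonnegative selfadjoint contraction with trivial kernel. *)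

theory Defs
  imports "HOL-Analysis.Analysis"
begin

text \<open>Complex inner product spaces. The real inner product, and with it the norm, the topology and
  the positive definiteness, come from \<open>real_inner\<close>; the complex inner product \<open>cinner\<close> is linear in
  its first argument and has the real one as its real part.\<close>

class complex_inner = real_inner +
  fixes scaleC :: "complex \<Rightarrow> 'a \<Rightarrow> 'a"
    and cinner :: "'a \<Rightarrow> 'a \<Rightarrow> complex"
  assumes scaleC_add_right: "scaleC a (x + y) = scaleC a x + scaleC a y"
    and scaleC_add_left: "scaleC (a + b) x = scaleC a x + scaleC b x"
    and scaleC_scaleC: "scaleC a (scaleC b x) = scaleC (a * b) x"
    and scaleC_of_real: "scaleC (complex_of_real r) x = scaleR r x"
    and cinner_commute: "cinner x y = cnj (cinner y x)"
    and cinner_add_left: "cinner (x + y) z = cinner x z + cinner y z"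
    and cinner_scaleC_left: "cinner (scaleC a x) y = a * cinner x y"
    and Re_cinner: "Re (cinner x y) = inner x y"

lemma cinner_self: "cinner x x = complex_of_real ((norm x)\<^sup>2)"
proof (rule complex_eqI)
  have "Im (cinner x x) = - Im (cinner x x)"
    by (metis cinner_commute cnj.sel(2))
  then show "Im (cinner x x) = Im (complex_of_real ((norm x)\<^sup>2))"
    by simp
qed (simp add: Re_cinner power2_norm_eq_inner)

text \<open>Separable complex Hilbert spaces; a metric space is separable iff it is second countable.\<close>

class complex_hilbert = complex_inner + complete_space + second_countable_topology

instantiation complex :: complex_hilbert
begin

definition scaleC_complex :: "complex \<Rightarrow> complex \<Rightarrow> complex"
  where "scaleC_complex = (*)"

definition cinner_complex :: "complex \<Rightarrow> complex \<Rightarrow> complex"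
  where "cinner_complex x y = x * cnj y"

instance
  by standard
    (auto simp: scaleC_complex_def cinner_complex_def algebra_simps scaleR_conv_of_real
      inner_complex_def)

end

text \<open>The orthogonal sum of two spaces is the product type, with the norm and the inner product of
  \<open>HOL-Analysis.Product_Vector\<close>.\<close>

instantiation prod :: (complex_inner, complex_inner) complex_inner
begin

definition scaleC_prod :: "complex \<Rightarrow> 'a \<times> 'b \<Rightarrow> 'a \<times> 'b"
  where "scaleC_prod a p = (scaleC a (fst p), scaleC a (snd p))"

definition cinner_prod :: "'a \<times> 'b \<Rightarrow> 'a \<times> 'b \<Rightarrow> complex"
  where "cinner_prod p q = cinner (fst p) (fst q) + cinner (snd p) (snd q)"

instance
proof
  fix p q :: "'a \<times> 'b"
  show "cinner p q = cnj (cinner q p)"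
    unfolding cinner_prod_def by (metis cinner_commute complex_cnj_add)
qed (auto simp: scaleC_prod_def cinner_prod_def scaleC_add_right scaleC_add_left scaleC_scaleC
    scaleC_of_real cinner_add_left cinner_scaleC_left Re_cinner inner_prod_def algebra_simps
    scaleR_prod_def)

end

instance prod :: (complex_hilbert, complex_hilbert) complex_hilbert ..

definition bounded_clinear :: "('a::complex_inner \<Rightarrow> 'b::complex_inner) \<Rightarrow> bool"
  where "bounded_clinear T \<longleftrightarrow> bounded_linear T \<and> (\<forall>a x. T (scaleC a x) = scaleC a (T x))"

definition contraction :: "('a::complex_inner \<Rightarrow> 'b::complex_inner) \<Rightarrow> bool"
  where "contraction T \<longleftrightarrow> bounded_clinear T \<and> (\<forall>x. norm (T x) \<le> norm x)"

definition cadj :: "('a::complex_inner \<Rightarrow> 'b::complex_inner) \<Rightarrow> 'b \<Rightarrow> 'a"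
  where "cadj T = (THE S. \<forall>x y. cinner (T x) y = cinner x (S y))"

definition selfadjoint :: "('a::complex_inner \<Rightarrow> 'a) \<Rightarrow> bool"
  where "selfadjoint S \<longleftrightarrow> bounded_clinear S \<and> (\<forall>x y. cinner (S x) y = cinner x (S y))"

definition nonneg_op :: "('a::complex_inner \<Rightarrow> 'a) \<Rightarrow> bool"
  where "nonneg_op S \<longleftrightarrow> selfadjoint S \<and> (\<forall>x. 0 \<le> Re (cinner (S x) x))"

definition le_op :: "('a::complex_inner \<Rightarrow> 'a) \<Rightarrow> ('a \<Rightarrow> 'a) \<Rightarrow> bool"
  where "le_op S R \<longleftrightarrow> nonneg_op (\<lambda>x. R x - S x)"

definition op_sqrt :: "('a::complex_inner \<Rightarrow> 'a) \<Rightarrow> 'a \<Rightarrow> 'a"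
  where "op_sqrt S = (THE R. nonneg_op R \<and> R \<circ> R = S)"

text \<open>The defect operator \<open>D\<^sub>T = (I - T* T)\<^sup>1\<^sup>/\<^sup>2\<close> of a contraction.\<close>

definition defect :: "('a::complex_inner \<Rightarrow> 'b::complex_inner) \<Rightarrow> 'a \<Rightarrow> 'a"
  where "defect T = op_sqrt (\<lambda>x. x - cadj T (T x))"

text \<open>The shorted operator of a bounded \<open>S \<ge> 0\<close> to a closed subspace \<open>K\<close>. The maximum exists by a
  theorem of Krein, and is unique because the operator order is antisymmetric.\<close>

definition shorted :: "('a::complex_inner \<Rightarrow> 'a) \<Rightarrow> 'a set \<Rightarrow> 'a \<Rightarrow> 'a"
  where "shorted S K =
    (THE Z. (nonneg_op Z \<and> le_op Z S \<and> range Z \<subseteq> K) \<and>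
      (\<forall>W. nonneg_op W \<and> le_op W S \<and> range W \<subseteq> K \<longrightarrow> le_op W Z))"

definition block_op ::
    "('h \<Rightarrow> 'h) \<Rightarrow> ('m \<Rightarrow> 'h) \<Rightarrow> ('h \<Rightarrow> 'n) \<Rightarrow> ('m \<Rightarrow> 'n) \<Rightarrow> 'h \<times> 'm \<Rightarrow> 'h::plus \<times> 'n::plus"
  where "block_op A B C D = (\<lambda>(h, m). (A h + B m, C h + D m))"

text \<open>The first summand as a subspace of the sum, and the orthogonal projection onto the second
  summand as an operator in the sum.\<close>

definition fst_space :: "('h \<times> 'm::zero) set"
  where "fst_space = UNIV \<times> {0}"

definition proj_snd :: "'h::zero \<times> 'm \<Rightarrow> 'h \<times> 'm"
  where "proj_snd p = (0, snd p)"

text \<open>For an operator \<open>Y\<close> in the first summand, the operator \<open>Y P\<close> in the sum, where \<open>P\<close> is the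
  orthogonal projection onto the first summand.\<close>

definition after_proj_fst :: "('h \<Rightarrow> 'h) \<Rightarrow> 'h \<times> 'm \<Rightarrow> 'h \<times> 'm::zero"
  where "after_proj_fst Y p = (Y (fst p), 0)"

text \<open>For nonnegative \<open>S\<close> in the sum, the range of the square root of the operator shorted to the
  first summand, regarded as a linear manifold of the first summand itself: the range lies in
  \<open>fst_space\<close>, which \<open>fst\<close> identifies with the first summand.\<close>

definition ran_sqrt_shorted ::
    "('h::complex_inner \<times> 'm::complex_inner \<Rightarrow> 'h \<times> 'm) \<Rightarrow> 'h set"
  where "ran_sqrt_shorted S = fst ` range (op_sqrt (shorted S fst_space))"

text \<open>The condition \<open>0 < X \<le> I\<close>: a nonnegative selfadjoint contraction with trivial kernel.\<close>

definition pos_contraction :: "('a::complex_inner \<Rightarrow> 'a) \<Rightarrow> bool"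
  where "pos_contraction X \<longleftrightarrow> nonneg_op X \<and> contraction X \<and> (\<forall>x. X x = 0 \<longrightarrow> x = 0)"

definition riccati ::
    "('h::complex_inner \<times> 'm::complex_inner \<Rightarrow> 'h \<times> 'n::complex_inner) \<Rightarrow> ('h \<Rightarrow> 'h) \<Rightarrow> bool"
  where "riccati T X \<longleftrightarrow>
    after_proj_fst (\<lambda>h. h - X h) =
      shorted (\<lambda>p. (defect T ^^ 2) p + cadj T (after_proj_fst (\<lambda>h. h - X h) (T p))) fst_space"

end

theory Submission
  imports Defs
begin

text \<open>Let \<open>Y = I - X\<close> and write \<open>S\<close> for the operator that is shorted in the Riccati equation. A
  vector lies in \<open>ran S\<^sup>1\<^sup>/\<^sup>2\<close> iff the square of its inner product with \<open>u\<close> is bounded by a multiple of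
  \<open>(S u, u)\<close> (Douglas), and shorting to \<open>H\<close> intersects this range with \<open>H\<close>. Take \<open>y\<close> in
  \<open>ran Y\<^sup>1\<^sup>/\<^sup>2\<close>. The equation puts \<open>(y, 0)\<close> into \<open>ran S\<^sup>1\<^sup>/\<^sup>2\<close>, so \<open>(y, 0) = D\<^sub>T a + T* (z, 0)\<close> with
  \<open>z\<close> in \<open>ran Y\<^sup>1\<^sup>/\<^sup>2\<close>. Since \<open>S\<close> is at most the square of the defect operator of \<open>P\<^sub>N T\<close>, the vector
  \<open>(z, 0)\<close> is in the range of the latter. Applying \<open>T\<close> gives
  \<open>(z, 0) = T (y, 0) - T D\<^sub>T a + (I - T T*) (z, 0)\<close>, which is in the range of the defect operator of
  \<open>P\<^sub>M T*\<close>. By the range hypothesis \<open>(z, 0)\<close> is in the range of the defect operator of \<open>T*\<close>, so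
  \<open>T* (z, 0)\<close>, and with it \<open>(y, 0)\<close>, is in \<open>ran D\<^sub>T\<close>. As the shorted operator of \<open>D\<^sub>T\<^sup>2\<close> vanishes,
  \<open>y = 0\<close>.\<close>

section \<open>Representation of functionals by minimization\<close>

text \<open>With \<open>A\<close> the identity this is the Riesz representation theorem (on the whole space) or the
  existence of orthogonal projections (on a closed subspace); in general it is the core of Douglas'
  lemma. The vector \<open>w\<close> is the limit of \<open>A u\<close> along a minimizing sequence of
  \<open>\<parallel>A u\<parallel>\<^sup>2 - 2 f u\<close>.\<close>

lemma minimizer_exists:
  fixes A :: "'a::real_vector \<Rightarrow> 'b::{real_inner,complete_space}" and f :: "'a \<Rightarrow> real"
  assumes E: "subspace E" and A: "linear A" and f: "linear f"
    and c: "0 \<le> c" and le: "\<And>u. u \<in> E \<Longrightarrow> \<bar>f u\<bar> \<le> c * norm (A u)"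
  obtains w where "w \<in> closure (A ` E)" and "norm w \<le> c"
    and "\<And>u. u \<in> E \<Longrightarrow> f u = inner w (A u)"
proof -
  define J where "J u = (norm (A u))\<^sup>2 - 2 * f u" for u
  define m where "m = Inf (J ` E)"
  have lower: "- (c\<^sup>2) \<le> J u" if "u \<in> E" for u
  proof -
    have "0 \<le> (norm (A u) - c)\<^sup>2" by simp
    moreover have "f u \<le> c * norm (A u)" using le[OF that] by linarith
    ultimately show ?thesis by (simp add: J_def power2_eq_square algebra_simps)
  qed
  have bdd: "bdd_below (J ` E)" using lower by (auto intro!: bdd_belowI)
  have ne: "J ` E \<noteq> {}" using subspace_0[OF E] by auto
  have mle: "m \<le> J u" if "u \<in> E" for u
    unfolding m_def using that bdd by (auto intro: cInf_lower)
  have "\<exists>u. u \<in> E \<and> J u < m + 1 / real (Suc n)" for n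
    using cInf_lessD[OF ne, of "m + 1 / real (Suc n)"] unfolding m_def by auto
  then obtain U where UE: "\<And>n. U n \<in> E" and UJ: "\<And>n. J (U n) < m + 1 / real (Suc n)" by metis
  \<comment> \<open>Parallelogram identity: \<open>J\<close> at the midpoint is at least
    \<open>m\<close>, so points where \<open>J\<close> is nearly minimal have nearby images under
    \<open>A\<close>.\<close>
  have par: "(norm (A u - A v))\<^sup>2 \<le> 2 * (J u - m) + 2 * (J v - m)" if "u \<in> E" "v \<in> E" for u v
  proof -
    define h where "h = (1/2) *\<^sub>R (u + v)"
    have hE: "h \<in> E" unfolding h_def using that E by (simp add: subspace_add subspace_scale)
    have Ah: "A h = (1/2) *\<^sub>R (A u + A v)"
      unfolding h_def by (simp add: linear_add[OF A] linear_scale[OF A])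
    have fh: "f h = (1/2) * (f u + f v)"
      unfolding h_def by (simp add: linear_add[OF f] linear_scale[OF f])
    have "(norm (A u - A v))\<^sup>2 = 2 * J u + 2 * J v - 4 * J h"
      unfolding J_def Ah fh
      by (simp add: power2_norm_eq_inner inner_add inner_diff inner_commute algebra_simps)
    also have "\<dots> \<le> 2 * J u + 2 * J v - 4 * m" using mle[OF hE] by simp
    finally show ?thesis by (simp add: algebra_simps)
  qed
  have "Cauchy (\<lambda>n. A (U n))"
  proof (rule CauchyI)
    fix e :: real assume e: "0 < e"
    \<comment> \<open>By \<open>par\<close>, two errors \<open>J (U k) - m\<close>, each below
      \<open>1 / (k + 1)\<close> and each doubled, have to stay below \<open>e^2\<close>; hence the
      4.\<close>
    obtain N where N: "4 / e\<^sup>2 < real N" using reals_Archimedean2 by blast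
    have "norm (A (U i) - A (U j)) < e" if "i \<ge> N" "j \<ge> N" for i j
    proof -
      have small: "2 * (J (U k) - m) < e\<^sup>2 / 2" if "k \<ge> N" for k
      proof -
        have "4 < real (Suc k) * e\<^sup>2"
        proof -
          have "4 < real N * e\<^sup>2" using N e by (simp add: divide_less_eq)
          also have "\<dots> \<le> real (Suc k) * e\<^sup>2" using that by (intro mult_right_mono) auto
          finally show ?thesis .
        qed
        then have "2 * (1 / real (Suc k)) < e\<^sup>2 / 2" by (simp add: field_simps)
        with UJ[of k] show ?thesis by (simp add: algebra_simps)
      qed
      have "(norm (A (U i) - A (U j)))\<^sup>2 < e\<^sup>2"
        using par[OF UE UE, of i j] small[OF that(1)] small[OF that(2)] by linarith
      then show ?thesis using e by (simp add: power2_less_imp_less)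
    qed
    then show "\<exists>M. \<forall>i\<ge>M. \<forall>j\<ge>M. norm (A (U i) - A (U j)) < e" by blast
  qed
  then obtain w where w: "(\<lambda>n. A (U n)) \<longlonglongrightarrow> w"
    using Cauchy_convergent convergent_def by blast
  have "w \<in> closure (A ` E)"
    using w UE unfolding closure_sequential by (intro exI[of _ "\<lambda>n. A (U n)"]) auto
  moreover have rep: "f u = inner w (A u)" if u: "u \<in> E" for u
  proof -
    define q where "q = (norm (A u))\<^sup>2"
    define d where "d = inner w (A u) - f u"
    \<comment> \<open>First variation: this is the limit of
      \<open>J (U n + t u) - m \<ge> 0\<close>, as \<open>J (U n) - m\<close> tends to 0.\<close>
    have "0 \<le> 2 * t * d + t\<^sup>2 * q" for t
    proof -
      have ineq: "0 \<le> 1 / real (Suc n) + 2 * t * (inner (A (U n)) (A u) - f u) + t\<^sup>2 * q" for n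
      proof -
        have "U n + t *\<^sub>R u \<in> E" using UE u E by (simp add: subspace_add subspace_scale)
        from mle[OF this] have "m \<le> J (U n) + 2 * t * (inner (A (U n)) (A u) - f u) + t\<^sup>2 * q"
          unfolding J_def q_def
          by (simp add: linear_add[OF A] linear_scale[OF A] linear_add[OF f] linear_scale[OF f]
              power2_norm_eq_inner inner_add inner_commute algebra_simps power2_eq_square[of t])
        then show ?thesis using UJ[of n] by linarith
      qed
      have "(\<lambda>n. 1 / real (Suc n) + 2 * t * (inner (A (U n)) (A u) - f u) + t\<^sup>2 * q)
          \<longlonglongrightarrow> 0 + 2 * t * (inner w (A u) - f u) + t\<^sup>2 * q"
        by (intro tendsto_intros w LIMSEQ_inverse_real_of_nat[unfolded inverse_eq_divide])
      from LIMSEQ_le_const[OF this] ineq show ?thesis unfolding d_def by auto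
    qed
    \<comment> \<open>The denominator is \<open>q + 1\<close> because \<open>q\<close> vanishes when
      \<open>A u = 0\<close>; the value obtained is still negative unless
      \<open>d = 0\<close>.\<close>
    from this[of "- d / (q + 1)"] have "0 \<le> - (d\<^sup>2 * (q + 2) / (q + 1)\<^sup>2)"
    proof -
      have q: "q + 1 > 0" unfolding q_def by (smt (verit) zero_le_power2)
      have "2 * (- d / (q + 1)) * d + (- d / (q + 1))\<^sup>2 * q = - (d\<^sup>2 * (q + 2) / (q + 1)\<^sup>2)"
        using q by (simp add: divide_simps) (simp add: power2_eq_square algebra_simps)
      then show ?thesis using \<open>0 \<le> 2 * (- d / (q + 1)) * d + (- d / (q + 1))\<^sup>2 * q\<close> by simp
    qed
    moreover have "q \<ge> 0" unfolding q_def by simp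
    ultimately have "d\<^sup>2 \<le> 0"
      by (smt (verit, best) divide_pos_pos mult_pos_pos zero_less_power)
    then show ?thesis unfolding d_def by simp
  qed
  \<comment> \<open>The representation tested at \<open>U n\<close> gives
    \<open>(norm w)^2 \<le> c * norm w\<close> in the limit.\<close>
  moreover have "norm w \<le> c"
  proof -
    have "inner w (A (U n)) \<le> c * norm (A (U n))" for n
      using rep[OF UE, of n] le[OF UE, of n] by linarith
    moreover have "(\<lambda>n. inner w (A (U n))) \<longlonglongrightarrow> inner w w"
      and "(\<lambda>n. c * norm (A (U n))) \<longlonglongrightarrow> c * norm w"
      by (intro tendsto_intros w)+
    ultimately have "inner w w \<le> c * norm w"
      by (meson LIMSEQ_le)
    then have "norm w * norm w \<le> c * norm w"
      by (simp add: power2_norm_eq_inner[symmetric] power2_eq_square)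
    then show ?thesis using c by (cases "w = 0") (auto simp: mult_le_cancel_right)
  qed
  ultimately show thesis using that by blast
qed

section \<open>Semidefinite forms and square roots\<close>

text \<open>The form may degenerate, so the proof evaluates it on real combinations of
  \<open>x\<close> and \<open>y\<close> and treats \<open>(S y, y) = 0\<close> separately.\<close>

lemma semidefinite_Cauchy_Schwarz:
  fixes S :: "'a::real_inner \<Rightarrow> 'a"
  assumes S: "linear S" and sym: "\<And>x y. inner (S x) y = inner x (S y)"
    and pos: "\<And>x. 0 \<le> inner (S x) x"
  shows "(inner (S x) y)\<^sup>2 \<le> inner (S x) x * inner (S y) y"
proof -
  let ?p = "inner (S x) x" and ?q = "inner (S y) y" and ?b = "inner (S x) y"
  have quad: "0 \<le> s\<^sup>2 * ?p + 2 * s * t * ?b + t\<^sup>2 * ?q" for s t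
    using pos[of "s *\<^sub>R x + t *\<^sub>R y"] sym[of y x]
    by (simp add: linear_add[OF S] linear_scale[OF S] inner_add inner_commute algebra_simps
        power2_eq_square)
  show ?thesis
  proof (cases "?q = 0")
    case True
    show ?thesis
    proof (rule ccontr)
      assume "\<not> ?thesis"
      with True have b: "?b \<noteq> 0" by auto
      \<comment> \<open>With \<open>?q = 0\<close> and \<open>s = 1\<close> the form is affine in
        \<open>t\<close>, and this \<open>t\<close> gives it the value -1.\<close>
      have "0 \<le> ?p + 2 * (- (?p + 1) / (2 * ?b)) * ?b"
        using quad[of 1 "- (?p + 1) / (2 * ?b)"] True by simp
      with b show False by (simp add: field_simps)
    qed
  next
    case False
    then have q: "?q > 0" using pos[of y] by linarith
    \<comment> \<open>For \<open>s = ?q\<close> the form is least at \<open>t = - ?b\<close>, where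
      a factor \<open>?q\<close> splits off.\<close>
    have "0 \<le> ?q * (?p * ?q - ?b\<^sup>2)"
      using quad[of "?q" "- ?b"] by (simp add: algebra_simps power2_eq_square)
    with q show ?thesis by (simp add: zero_le_mult_iff)
  qed
qed

lemma semidefinite_form_zero:
  fixes S :: "'a::real_inner \<Rightarrow> 'a"
  assumes "linear S" and "\<And>x y. inner (S x) y = inner x (S y)"
    and "\<And>x. 0 \<le> inner (S x) x" and "inner (S x) x = 0"
  shows "S x = 0"
  using semidefinite_Cauchy_Schwarz[OF assms(1-3), of x "S x"] assms(4) by simp

text \<open>The solution of \<open>2 L = B + L\<^sup>2\<close> is the limit of the iteration \<open>Z \<mapsto> (B + Z\<^sup>2) / 2\<close>. It
  converges in operator norm, its increments being dominated by those of the same iteration for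
  \<open>B = 1\<close> in the reals, which is increasing and bounded by 1. Then \<open>I - L\<close> is a square root of
  \<open>I - B\<close>.\<close>

lemma sqrt_iteration_limit_exists:
  fixes B :: "'a::{real_inner,banach} \<Rightarrow>\<^sub>L 'a"
  assumes B: "norm B \<le> 1" and sym: "\<And>x y. inner (B x) y = inner x (B y)"
  obtains L :: "'a \<Rightarrow>\<^sub>L 'a" where "norm L \<le> 1" and "\<And>x y. inner (L x) y = inner x (L y)"
    and "\<And>x. 2 *\<^sub>R L x = B x + L (L x)"
    and "\<And>C. C o\<^sub>L B = B o\<^sub>L C \<Longrightarrow> C o\<^sub>L L = L o\<^sub>L C"
proof -
  define Y where "Y = rec_nat (0 :: 'a \<Rightarrow>\<^sub>L 'a) (\<lambda>_ Z. (1/2) *\<^sub>R (B + (Z o\<^sub>L Z)))"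
  define y where "y = rec_nat (0::real) (\<lambda>_ z. (1/2) * (1 + z * z))"
  have Y0: "Y 0 = 0" and YS: "Y (Suc n) = (1/2) *\<^sub>R (B + (Y n o\<^sub>L Y n))" for n
    by (simp_all add: Y_def)
  have y0: "y 0 = 0" and yS: "y (Suc n) = (1/2) * (1 + y n * y n)" for n
    by (simp_all add: y_def)
  have y01: "0 \<le> y n \<and> y n \<le> 1" for n
  proof (induction n)
    case (Suc n)
    then have "y n * y n \<le> 1 * 1" by (intro mult_mono) auto
    then show ?case by (simp add: yS)
  qed (simp add: y0)
  \<comment> \<open>The iterates are polynomials in \<open>B\<close>, so they commute with whatever
    commutes with \<open>B\<close>, and hence with each other.\<close>
  have comm: "C o\<^sub>L Y n = Y n o\<^sub>L C" if C: "C o\<^sub>L B = B o\<^sub>L C" for C n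
  proof (induction n)
    case (Suc n)
    have a: "C (B x) = B (C x)" for x
      using arg_cong[OF C, of "\<lambda>F. blinfun_apply F x"] by simp
    have b: "C (Y n x) = Y n (C x)" for x
      using arg_cong[OF Suc, of "\<lambda>F. blinfun_apply F x"] by simp
    show ?case
      by (rule blinfun_eqI)
        (simp add: YS a b blinfun.scaleR_left blinfun.scaleR_right blinfun.add_left blinfun.add_right)
  qed (simp add: Y0 blinfun_eqI)
  have YY: "Y n o\<^sub>L Y k = Y k o\<^sub>L Y n" for n k
    using comm[of "Y n" k] comm[of B n] by simp
  have Ysym: "inner (Y n u) v = inner u (Y n v)" for n u v
  proof (induction n arbitrary: u v)
    case (Suc n)
    show ?case
      by (simp add: YS Suc sym blinfun.scaleR_left blinfun.add_left inner_add)
  qed (simp add: Y0)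
  have Yn: "norm (Y n) \<le> y n" for n
  proof (induction n)
    case (Suc n)
    have "norm (Y n o\<^sub>L Y n) \<le> norm (Y n) * norm (Y n)" by (rule norm_blinfun_compose)
    also have "\<dots> \<le> y n * y n" using Suc y01[of n] by (intro mult_mono) auto
    finally have "norm (B + (Y n o\<^sub>L Y n)) \<le> 1 + y n * y n"
      using B norm_triangle_ineq[of B "Y n o\<^sub>L Y n"] by linarith
    then show ?case by (simp add: YS yS)
  qed (simp add: Y0 y0)
  have diff: "norm (Y (Suc n) - Y n) \<le> y (Suc n) - y n" for n
  proof (induction n)
    case 0
    then show ?case using Yn[of "Suc 0"] by (simp add: Y0 y0)
  next
    case (Suc n)
    \<comment> \<open>A difference of squares, whose mixed terms cancel because the iterates
      commute; \<open>y\<close> factors in the same way.\<close>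
    have eq: "Y (Suc (Suc n)) - Y (Suc n)
        = (1/2) *\<^sub>R ((Y (Suc n) + Y n) o\<^sub>L (Y (Suc n) - Y n))"
    proof -
      have "Y (Suc n) (Y n x) = Y n (Y (Suc n) x)" for x
        using arg_cong[OF YY[of "Suc n" n], of "\<lambda>F. blinfun_apply F x"] by simp
      then have "(Y (Suc n) + Y n) o\<^sub>L (Y (Suc n) - Y n) 
          = (Y (Suc n) o\<^sub>L Y (Suc n)) - (Y n o\<^sub>L Y n)"
        by (intro blinfun_eqI)
          (simp add: blinfun.add_left blinfun.diff_left blinfun.diff_right)
      then show ?thesis by (simp add: YS[of "Suc n"] YS[of n] scaleR_diff_right[symmetric])
    qed
    have "norm ((Y (Suc n) + Y n) o\<^sub>L (Y (Suc n) - Y n))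
        \<le> norm (Y (Suc n) + Y n) * norm (Y (Suc n) - Y n)" by (rule norm_blinfun_compose)
    also have "\<dots> \<le> (y (Suc n) + y n) * (y (Suc n) - y n)"
      using Suc Yn[of n] Yn[of "Suc n"] y01[of n] y01[of "Suc n"]
        norm_triangle_ineq[of "Y (Suc n)" "Y n"]
      by (intro mult_mono) (auto intro: order_trans)
    also have "\<dots> = 2 * (y (Suc (Suc n)) - y (Suc n))"
      by (simp only: yS[of "Suc n"] yS[of n]) (simp add: algebra_simps)
    finally show ?case by (simp add: eq)
  qed
  have diff': "norm (Y (n + k) - Y n) \<le> y (n + k) - y n" for n k
  proof (induction k)
    case (Suc k)
    have "norm (Y (n + Suc k) - Y n) \<le> norm (Y (Suc (n + k)) - Y (n + k)) + norm (Y (n + k) - Y n)"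
      using norm_triangle_ineq[of "Y (Suc (n + k)) - Y (n + k)" "Y (n + k) - Y n"] by simp
    then show ?case using Suc diff[of "n + k"] by simp
  qed simp
  have "incseq y" using diff by (intro incseq_SucI) (smt (verit) norm_ge_zero)
  then obtain l where "y \<longlonglongrightarrow> l" using incseq_convergent[of y 1] y01 by metis
  then have Cy: "Cauchy y" by (rule LIMSEQ_imp_Cauchy)
  have "Cauchy Y"
  proof (rule CauchyI')
    fix e :: real assume "0 < e"
    then obtain M where M: "\<And>i j. i \<ge> M \<Longrightarrow> j \<ge> M \<Longrightarrow> norm (y i - y j) < e"
      using CauchyD[OF Cy] by blast
    have "norm (Y i - Y j) < e" if "i \<ge> M" and ij: "j > i" for i j
    proof -
      obtain k where k: "j = i + k" using ij less_imp_add_positive by blast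
      have "norm (Y j - Y i) \<le> y j - y i" unfolding k by (rule diff')
      then show ?thesis using M[of j i] that by (simp add: norm_minus_commute abs_less_iff)
    qed
    then show "\<exists>M. \<forall>m\<ge>M. \<forall>n>m. dist (Y m) (Y n) < e"
      unfolding dist_norm by blast
  qed
  then obtain L where L: "Y \<longlonglongrightarrow> L" using Cauchy_convergent convergent_def by blast
  have Lx: "(\<lambda>n. Y n x) \<longlonglongrightarrow> L x" for x by (intro tendsto_intros L)
  show thesis
  proof (rule that[of L])
    show "norm L \<le> 1"
      using LIMSEQ_le_const2[OF tendsto_norm[OF L], of 1] Yn y01 by (meson order_trans)
    show "inner (L u) v = inner u (L v)" for u v
    proof (rule LIMSEQ_unique)
      show "(\<lambda>n. inner (Y n u) v) \<longlonglongrightarrow> inner (L u) v" by (intro tendsto_intros Lx)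
      show "(\<lambda>n. inner (Y n u) v) \<longlonglongrightarrow> inner u (L v)"
        unfolding Ysym by (intro tendsto_intros Lx)
    qed
    have "L = (1/2) *\<^sub>R (B + (L o\<^sub>L L))"
    proof (rule LIMSEQ_unique)
      show "(\<lambda>n. Y (Suc n)) \<longlonglongrightarrow> L" using L by (rule LIMSEQ_Suc)
      show "(\<lambda>n. Y (Suc n)) \<longlonglongrightarrow> (1/2) *\<^sub>R (B + (L o\<^sub>L L))"
        unfolding YS
        by (intro tendsto_intros bounded_bilinear.tendsto[OF bounded_bilinear_blinfun_compose] L)
    qed
    then have "2 *\<^sub>R L = B + (L o\<^sub>L L)"
      by (metis scaleR_half_double scaleR_scaleR scaleR_2 real_scaleR_def scaleR_add_right)
    then show "2 *\<^sub>R L x = B x + L (L x)" for x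
      by (metis blinfun.add_left blinfun.scaleR_left blinfun_apply_blinfun_compose)
    show "C o\<^sub>L L = L o\<^sub>L C" if "C o\<^sub>L B = B o\<^sub>L C" for C
    proof (rule LIMSEQ_unique)
      show "(\<lambda>n. C o\<^sub>L Y n) \<longlonglongrightarrow> (C o\<^sub>L L)"
        by (intro bounded_bilinear.tendsto[OF bounded_bilinear_blinfun_compose] L tendsto_const)
      show "(\<lambda>n. C o\<^sub>L Y n) \<longlonglongrightarrow> (L o\<^sub>L C)"
        unfolding comm[OF that]
        by (intro bounded_bilinear.tendsto[OF bounded_bilinear_blinfun_compose] L tendsto_const)
    qed
  qed
qed

text \<open>With \<open>c\<close> a bound of \<open>S\<close>, the iteration is applied to
  \<open>B = I - S / c\<close>. Then \<open>R = sqrt c (I - L)\<close> has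
  \<open>R^2 = c (I - 2 L + L^2) = c (I - B) = S\<close>. The commutation clause later gives complex
  linearity and uniqueness of the root.\<close>

lemma semidefinite_sqrt_exists:
  fixes S :: "'a::{real_inner,banach} \<Rightarrow> 'a"
  assumes S: "bounded_linear S" and sym: "\<And>x y. inner (S x) y = inner x (S y)"
    and pos: "\<And>x. 0 \<le> inner (S x) x"
  obtains R where "bounded_linear R" and "\<And>x y. inner (R x) y = inner x (R y)"
    and "\<And>x. 0 \<le> inner (R x) x" and "\<And>x. R (R x) = S x"
    and "\<And>C x. bounded_linear C \<Longrightarrow> (\<And>x. C (S x) = S (C x)) \<Longrightarrow> C (R x) = R (C x)"
proof -
  obtain c where c: "c > 0" and Sc: "\<And>x. norm (S x) \<le> norm x * c"
    using bounded_linear.pos_bounded[OF S] by blast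
  have lin: "linear S" using S by (rule bounded_linear.linear)
  have Sle: "inner (S x) x \<le> c * (norm x)\<^sup>2" for x
  proof -
    have "inner (S x) x \<le> norm (S x) * norm x" by (rule norm_cauchy_schwarz)
    also have "\<dots> \<le> (norm x * c) * norm x" using Sc by (intro mult_right_mono) auto
    finally show ?thesis by (simp add: power2_eq_square algebra_simps)
  qed
  \<comment> \<open>Cauchy-Schwarz for the pair \<open>x\<close>, \<open>S x\<close>, with
    \<open>(norm (S x))^2\<close> cancelled. This is what makes \<open>I - S / c\<close> a
    contraction.\<close>
  have S2: "(norm (S x))\<^sup>2 \<le> c * inner (S x) x" for x
  proof (cases "S x = 0")
    case False
    have "((norm (S x))\<^sup>2)\<^sup>2 \<le> inner (S x) x * inner (S (S x)) (S x)"
      using semidefinite_Cauchy_Schwarz[OF lin sym pos, of x "S x"]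
      by (simp add: power2_norm_eq_inner)
    also have "\<dots> \<le> inner (S x) x * (c * (norm (S x))\<^sup>2)"
      using Sle pos by (intro mult_left_mono) auto
    finally have "(norm (S x))\<^sup>2 * (norm (S x))\<^sup>2 \<le> (c * inner (S x) x) * (norm (S x))\<^sup>2"
      by (simp add: power2_eq_square algebra_simps)
    then show ?thesis using False by (subst (asm) mult_le_cancel_right) (simp add: not_less)
  qed simp
  define B where "B = Blinfun (\<lambda>x. x - (1/c) *\<^sub>R S x)"
  have "bounded_linear (\<lambda>x. x - (1/c) *\<^sub>R S x)"
    using S by (intro bounded_linear_sub bounded_linear_ident bounded_linear_scaleR_right
        bounded_linear_compose[OF bounded_linear_scaleR_right])
  then have B: "B x = x - (1/c) *\<^sub>R S x" for x
    unfolding B_def by (simp add: bounded_linear_Blinfun_apply)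
  have "norm B \<le> 1"
  proof (rule norm_blinfun_bound)
    fix x
    have "(norm (B x))\<^sup>2 = (norm x)\<^sup>2 - (2 * inner (S x) x) / c + (norm (S x))\<^sup>2 / c\<^sup>2"
      unfolding B power2_norm_eq_inner
      by (simp add: inner_diff inner_commute power2_eq_square algebra_simps)
    moreover have "(norm (S x))\<^sup>2 / c\<^sup>2 \<le> inner (S x) x / c"
      using S2[of x] c by (simp add: field_simps power2_eq_square)
    moreover have "0 \<le> inner (S x) x / c" using pos[of x] c by simp
    ultimately have "(norm (B x))\<^sup>2 \<le> (norm x)\<^sup>2" by simp
    from power2_le_imp_le[OF this] show "norm (B x) \<le> 1 * norm x" by simp
  qed simp
  moreover have "inner (B x) y = inner x (B y)" for x y
    unfolding B by (simp add: inner_diff sym)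
  ultimately obtain L :: "'a \<Rightarrow>\<^sub>L 'a" where L1: "norm L \<le> 1"
    and Lsym: "\<And>x y. inner (L x) y = inner x (L y)"
    and LL: "\<And>x. 2 *\<^sub>R L x = B x + L (L x)"
    and Lcomm: "\<And>C. C o\<^sub>L B = B o\<^sub>L C \<Longrightarrow> C o\<^sub>L L = L o\<^sub>L C"
    using sqrt_iteration_limit_exists[of B] by blast
  define R where "R x = sqrt c *\<^sub>R (x - L x)" for x
  show thesis
  proof (rule that[of R])
    show "bounded_linear R" unfolding R_def
      by (intro bounded_linear_sub bounded_linear_ident blinfun.bounded_linear_right
          bounded_linear_compose[OF bounded_linear_scaleR_right])
    show "inner (R x) y = inner x (R y)" for x y
      unfolding R_def by (simp add: inner_diff Lsym)
    show "0 \<le> inner (R x) x" for x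
    proof -
      have "inner (L x) x \<le> norm (L x) * norm x" by (rule norm_cauchy_schwarz)
      also have "\<dots> \<le> (1 * norm x) * norm x"
        using norm_blinfun[of L x] L1
        by (intro mult_right_mono) (meson mult_right_mono norm_ge_zero order_trans, simp)
      finally show ?thesis using c
        unfolding R_def by (simp add: inner_diff power2_norm_eq_inner[symmetric] power2_eq_square)
    qed
    show "R (R x) = S x" for x
    proof -
      have "R (R x) = (sqrt c * sqrt c) *\<^sub>R ((x - L x) - L (x - L x))"
        unfolding R_def
        by (simp only: blinfun.scaleR_right scaleR_diff_right[symmetric] scaleR_scaleR)
      also have "\<dots> = c *\<^sub>R (x - 2 *\<^sub>R L x + L (L x))"
        using c by (simp add: blinfun.diff_right scaleR_2)
      also have "x - 2 *\<^sub>R L x + L (L x) = (1/c) *\<^sub>R S x"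
        unfolding LL B by simp
      finally show ?thesis using c by simp
    qed
    show "C (R x) = R (C x)" if C: "bounded_linear C" and CS: "\<And>x. C (S x) = S (C x)" for C x
    proof -
      interpret C: bounded_linear C by (rule C)
      have Ca: "blinfun_apply (Blinfun C) = C" by (rule bounded_linear_Blinfun_apply[OF C])
      have "Blinfun C o\<^sub>L B = B o\<^sub>L Blinfun C"
        by (rule blinfun_eqI) (simp add: Ca B C.diff C.scaleR CS)
      from Lcomm[OF this] have "C (L x) = L (C x)"
        by (metis Ca blinfun_apply_blinfun_compose)
      then show ?thesis unfolding R_def by (simp add: C.diff C.scaleR)
    qed
  qed
qed

instance complex_hilbert \<subseteq> banach ..

section \<open>Ranges described by quadratic forms\<close>

text \<open>Douglas' range criterion as a condition on a form: for
  \<open>q u = (norm (V' u))^2\<close>, with \<open>V'\<close> adjoint to \<open>V\<close>, it means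
  that \<open>x\<close> lies in \<open>ran V\<close>. In this shape, inclusions of ranges follow
  from inequalities between forms.\<close>

definition dominated :: "('a::real_inner \<Rightarrow> real) \<Rightarrow> 'a \<Rightarrow> bool"
  where "dominated q x \<longleftrightarrow> (\<exists>c\<ge>0. \<forall>u. (inner x u)\<^sup>2 \<le> c * q u)"

lemma dominatedI: "0 \<le> c \<Longrightarrow> (\<And>u. (inner x u)\<^sup>2 \<le> c * q u) \<Longrightarrow> dominated q x"
  unfolding dominated_def by blast

lemma dominated_mono:
  assumes "dominated q x" and "\<And>u. q u \<le> r u"
  shows "dominated r x"
  using assms unfolding dominated_def by (meson mult_left_mono order_trans)

lemma dominated_add:
  assumes "dominated q x" and "dominated q y"
  shows "dominated q (x + y)"
proof -
  obtain c d where c: "c \<ge> 0" "\<And>u. (inner x u)\<^sup>2 \<le> c * q u"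
    and d: "d \<ge> 0" "\<And>u. (inner y u)\<^sup>2 \<le> d * q u"
    using assms unfolding dominated_def by metis
  show ?thesis
  proof (rule dominatedI)
    show "0 \<le> 2 * (c + d)" using c d by simp
    fix u
    have "0 \<le> (inner x u - inner y u)\<^sup>2" by simp
    then have "(inner (x + y) u)\<^sup>2 \<le> 2 * (inner x u)\<^sup>2 + 2 * (inner y u)\<^sup>2"
      by (simp add: inner_add power2_eq_square algebra_simps)
    then show "(inner (x + y) u)\<^sup>2 \<le> 2 * (c + d) * q u"
      using c(2)[of u] d(2)[of u] by (simp add: algebra_simps)
  qed
qed

text \<open>One direction is Cauchy-Schwarz. Conversely, \<open>inner x\<close> is bounded through
  \<open>V'\<close>, so the minimization lemma writes it as
  \<open>inner w (V' u) = inner (V w) u\<close>, and \<open>x = V w\<close>.\<close>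

lemma in_range_iff_dominated:
  fixes V :: "'b::{real_inner,complete_space} \<Rightarrow> 'a::real_inner"
  assumes adj: "\<And>a u. inner (V a) u = inner a (V' u)" and lin: "linear V'"
  shows "x \<in> range V \<longleftrightarrow> dominated (\<lambda>u. (norm (V' u))\<^sup>2) x"
proof
  assume "x \<in> range V"
  then obtain a where a: "x = V a" by blast
  show "dominated (\<lambda>u. (norm (V' u))\<^sup>2) x"
  proof (rule dominatedI)
    show "(inner x u)\<^sup>2 \<le> (norm a)\<^sup>2 * (norm (V' u))\<^sup>2" for u
      using Cauchy_Schwarz_ineq2[of a "V' u"] unfolding a adj
      by (metis abs_ge_zero power2_abs power_mono power_mult_distrib)
  qed simp
next
  assume "dominated (\<lambda>u. (norm (V' u))\<^sup>2) x"
  then obtain c where c: "c \<ge> 0" "\<And>u. (inner x u)\<^sup>2 \<le> c * (norm (V' u))\<^sup>2"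
    unfolding dominated_def by blast
  have "\<bar>inner x u\<bar> \<le> sqrt c * norm (V' u)" for u
    using real_sqrt_le_mono[OF c(2)[of u]] by (simp add: real_sqrt_mult)
  moreover have "linear (inner x)"
    by (rule bounded_linear.linear[OF bounded_linear_inner_right])
  ultimately obtain w where "\<And>u. inner x u = inner w (V' u)"
    using minimizer_exists[OF subspace_UNIV lin, of "inner x" "sqrt c"] c(1)
    by (metis UNIV_I real_sqrt_ge_0_iff)
  then have "x = V w" using adj by (metis vector_eq_rdot)
  then show "x \<in> range V" by blast
qed

section \<open>Complex structure, operator order and adjoints\<close>

lemma inner_scaleC_left: "inner (scaleC a x) y = inner x (scaleC (cnj a) y)"
  for x :: "'a::complex_inner"
proof -
  have "cinner (scaleC a x) y = cinner x (scaleC (cnj a) y)"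
    by (metis cinner_commute cinner_scaleC_left complex_cnj_cnj complex_cnj_mult)
  then show ?thesis by (metis Re_cinner)
qed

lemma Im_cinner: "Im (cinner x y) = inner (scaleC (- \<i>) x) y"
  by (simp add: Re_cinner[symmetric] cinner_scaleC_left)

text \<open>The imaginary part of \<open>cinner\<close> is a real inner product with a rotated
  vector, and a complex linear \<open>T\<close> commutes with the rotation. Adjoint relations can
  thus be proved for \<open>inner\<close> alone.\<close>

lemma cinner_adjointI:
  assumes "bounded_clinear T" and "\<And>x y. inner (T x) y = inner x (S y)"
  shows "cinner (T x) y = cinner x (S y)"
proof (rule complex_eqI)
  show "Re (cinner (T x) y) = Re (cinner x (S y))" by (simp add: Re_cinner assms(2))
  have "scaleC (- \<i>) (T x) = T (scaleC (- \<i>) x)" using assms(1) by (simp add: bounded_clinear_def)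
  then show "Im (cinner (T x) y) = Im (cinner x (S y))" by (simp add: Im_cinner assms(2))
qed

lemma bounded_clinear_bounded_linear: "bounded_clinear T \<Longrightarrow> bounded_linear T"
  by (simp add: bounded_clinear_def)

lemma bounded_clinear_linear: "bounded_clinear T \<Longrightarrow> linear T"
  by (simp add: bounded_clinear_def bounded_linear.linear)

lemma bounded_clinear_compose:
  "bounded_clinear S \<Longrightarrow> bounded_clinear T \<Longrightarrow> bounded_clinear (\<lambda>x. S (T x))"
  by (simp add: bounded_clinear_def bounded_linear_compose)

lemma bounded_clinear_add:
  "bounded_clinear S \<Longrightarrow> bounded_clinear T \<Longrightarrow> bounded_clinear (\<lambda>x. S x + T x)"
  by (simp add: bounded_clinear_def bounded_linear_add scaleC_add_right)

lemma scaleC_diff_right: "scaleC a (x - y) = scaleC a x - scaleC a y"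
  by (metis add_diff_cancel_right' diff_add_cancel scaleC_add_right)

lemma bounded_clinear_diff:
  "bounded_clinear S \<Longrightarrow> bounded_clinear T \<Longrightarrow> bounded_clinear (\<lambda>x. S x - T x)"
  by (simp add: bounded_clinear_def bounded_linear_sub scaleC_diff_right)

lemma bounded_clinear_ident: "bounded_clinear (\<lambda>x. x)"
  by (simp add: bounded_clinear_def bounded_linear_ident)

lemma nonneg_op_iff:
  "nonneg_op S \<longleftrightarrow> bounded_clinear S \<and> (\<forall>x y. inner (S x) y = inner x (S y))
    \<and> (\<forall>x. 0 \<le> inner (S x) x)"
  unfolding nonneg_op_def selfadjoint_def by (metis Re_cinner cinner_adjointI)

lemma nonneg_opD:
  assumes "nonneg_op S"
  shows "bounded_clinear S" and "linear S" and "inner (S x) y = inner x (S y)" and "0 \<le> inner (S x) x"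
  using assms unfolding nonneg_op_iff by (auto simp: bounded_clinear_linear)

lemma le_op_iff:
  assumes "nonneg_op S" and "nonneg_op R"
  shows "le_op S R \<longleftrightarrow> (\<forall>x. inner (S x) x \<le> inner (R x) x)"
  unfolding le_op_def nonneg_op_iff[of "\<lambda>x. R x - S x"]
  using bounded_clinear_diff[OF nonneg_opD(1)[OF assms(2)] nonneg_opD(1)[OF assms(1)]]
    nonneg_opD(3)[OF assms(1)] nonneg_opD(3)[OF assms(2)]
  by (simp add: inner_diff_left inner_diff_right)

lemma le_op_antisym:
  assumes "nonneg_op S" and "nonneg_op R" and "le_op S R" and "le_op R S"
  shows "S = R"
proof
  fix x
  have "nonneg_op (\<lambda>x. R x - S x)" using assms(3) by (simp add: le_op_def)
  note D = nonneg_opD[OF this]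
  have "inner (R x - S x) x = 0"
    using assms(3,4) by (simp add: le_op_iff assms(1,2) inner_diff order_antisym)
  from semidefinite_form_zero[OF D(2-4) this] show "S x = R x" by simp
qed

text \<open>Riesz representation of the functional \<open>inner (T x) y\<close> of \<open>x\<close>,
  by minimization with the identity as \<open>A\<close>.\<close>

lemma adjoint_exists:
  fixes T :: "'a::complex_hilbert \<Rightarrow> 'b::complex_inner"
  assumes T: "bounded_clinear T"
  obtains S where "bounded_clinear S" and "\<And>x y. inner (T x) y = inner x (S y)"
proof -
  obtain K where K: "K \<ge> 0" and TK: "\<And>x. norm (T x) \<le> norm x * K"
    using bounded_linear.nonneg_bounded[OF bounded_clinear_bounded_linear[OF T]] by blast
  have ex: "\<exists>s. \<forall>x. inner (T x) y = inner s x" for y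
  proof -
    have "linear (\<lambda>x. inner (T x) y)"
      using bounded_linear_compose[OF bounded_linear_inner_left bounded_clinear_bounded_linear[OF T]]
      by (rule bounded_linear.linear)
    moreover have "\<bar>inner (T x) y\<bar> \<le> K * norm y * norm x" for x
      using Cauchy_Schwarz_ineq2[of "T x" y] mult_right_mono[OF TK[of x], of "norm y"]
      by (simp add: mult_ac)
    ultimately show ?thesis
      using minimizer_exists[OF subspace_UNIV linear_id, of "\<lambda>x. inner (T x) y" "K * norm y"] K
      by (metis UNIV_I id_apply mult_nonneg_nonneg norm_ge_zero)
  qed
  then obtain S where S: "\<And>x y. inner (T x) y = inner x (S y)"
    by (metis inner_commute)
  have SK: "norm (S y) \<le> norm y * K" for y
  proof -
    have "norm (S y) * norm (S y) = inner (T (S y)) y"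
      by (simp add: S power2_norm_eq_inner[symmetric] power2_eq_square)
    also have "\<dots> \<le> norm (T (S y)) * norm y" by (rule norm_cauchy_schwarz)
    also have "\<dots> \<le> (norm (S y) * K) * norm y" using TK by (intro mult_right_mono) auto
    finally have "norm (S y) * norm (S y) \<le> norm (S y) * (norm y * K)" by (simp add: mult_ac)
    then show ?thesis using K by (cases "S y = 0") (simp_all add: mult_le_cancel_left)
  qed
  have "bounded_linear S"
  proof (rule bounded_linear_intro)
    show "S (x + y) = S x + S y" for x y
      by (rule vector_eq_ldot[THEN iffD1]) (simp add: inner_add S[symmetric])
    show "S (r *\<^sub>R x) = r *\<^sub>R S x" for r x
      by (rule vector_eq_ldot[THEN iffD1]) (simp add: S[symmetric])
  qed (rule SK)
  moreover have "S (scaleC a y) = scaleC a (S y)" for a y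
  proof (rule vector_eq_ldot[THEN iffD1], rule allI)
    fix x
    have "inner x (S (scaleC a y)) = inner (T (scaleC (cnj a) x)) y"
      using T by (simp add: S[symmetric] bounded_clinear_def inner_scaleC_left)
    then show "inner x (S (scaleC a y)) = inner x (scaleC a (S y))"
      by (simp add: S inner_scaleC_left)
  qed
  ultimately show thesis using that[of S] S unfolding bounded_clinear_def by blast
qed

lemma cadj_props:
  fixes T :: "'a::complex_hilbert \<Rightarrow> 'b::complex_inner"
  assumes T: "bounded_clinear T"
  shows bounded_clinear_cadj: "bounded_clinear (cadj T)"
    and inner_cadj: "inner (T x) y = inner x (cadj T y)"
proof -
  obtain S where S: "bounded_clinear S" and adj: "\<And>x y. inner (T x) y = inner x (S y)"
    using adjoint_exists[OF T] by blast
  have "cadj T = S" unfolding cadj_def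
  proof (rule the_equality)
    show "\<forall>x y. cinner (T x) y = cinner x (S y)" using cinner_adjointI[OF T adj] by blast
    fix R assume R: "\<forall>x y. cinner (T x) y = cinner x (R y)"
    have "inner x (R y) = inner x (S y)" for x y
      using R adj by (metis Re_cinner)
    then show "R = S" using vector_eq_ldot by blast
  qed
  with S adj show "bounded_clinear (cadj T)" and "inner (T x) y = inner x (cadj T y)" by simp_all
qed

section \<open>Complex square roots, projections and shorted operators\<close>

lemma op_sqrt_props:
  fixes S :: "'a::complex_hilbert \<Rightarrow> 'a"
  assumes S: "nonneg_op S"
  shows nonneg_op_sqrt: "nonneg_op (op_sqrt S)"
    and op_sqrt_sqrt: "op_sqrt S (op_sqrt S x) = S x"
proof -
  note SD = nonneg_opD[OF S]
  obtain R where R: "bounded_linear R" "\<And>x y. inner (R x) y = inner x (R y)"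
    "\<And>x. 0 \<le> inner (R x) x" and RR: "\<And>x. R (R x) = S x"
    and Rcomm: "\<And>C x. bounded_linear C \<Longrightarrow> (\<And>x. C (S x) = S (C x)) \<Longrightarrow> C (R x) = R (C x)"
    using semidefinite_sqrt_exists[OF bounded_clinear_bounded_linear[OF SD(1)] SD(3,4)] by blast
  \<comment> \<open>Multiplication by \<open>a\<close> is bounded, real linear and commutes with
    \<open>S\<close>, hence with \<open>R\<close>; this makes the root complex linear.\<close>
  have bl: "bounded_linear (scaleC a :: 'a \<Rightarrow> 'a)" for a :: complex
  proof -
    have "norm (scaleC a x) = cmod a * norm x" for x :: 'a
    proof -
      have "complex_of_real ((norm (scaleC a x))\<^sup>2) = (a * cnj a) * complex_of_real ((norm x)\<^sup>2)"
        unfolding cinner_self[symmetric]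
        by (metis cinner_commute cinner_scaleC_left complex_cnj_mult mult.assoc)
      then have "complex_of_real ((norm (scaleC a x))\<^sup>2) = complex_of_real ((cmod a * norm x)\<^sup>2)"
        by (simp add: complex_norm_square[symmetric] power_mult_distrib)
      then have "(norm (scaleC a x))\<^sup>2 = (cmod a * norm x)\<^sup>2" by (simp only: of_real_eq_iff)
      then show ?thesis by (simp add: power2_eq_iff_nonneg)
    qed
    moreover have "scaleC a (r *\<^sub>R x) = r *\<^sub>R scaleC a x" for r and x :: 'a
      by (simp add: scaleC_of_real[symmetric] scaleC_scaleC mult.commute)
    ultimately show ?thesis
      by (intro bounded_linear_intro[where K = "cmod a"]) (auto simp: scaleC_add_right mult.commute)
  qed
  have Rn: "nonneg_op R"
    unfolding nonneg_op_iff bounded_clinear_def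
    using R Rcomm[OF bl] SD(1) by (simp add: bounded_clinear_def)
  have "op_sqrt S = R" unfolding op_sqrt_def
  proof (rule the_equality)
    show "nonneg_op R \<and> R \<circ> R = S" using Rn RR by auto
    \<comment> \<open>\<open>Q\<close> commutes with \<open>Q^2 = S\<close> and hence with
      \<open>R\<close>, so \<open>(Q + R) (Q - R) = 0\<close>. Both forms being nonnegative,
      \<open>Q\<close> and \<open>R\<close> each annihilate \<open>y\<close>.\<close>
    fix Q assume "nonneg_op Q \<and> Q \<circ> Q = S"
    then have Q: "nonneg_op Q" and QQ: "\<And>x. Q (Q x) = S x" by auto
    note QD = nonneg_opD[OF Q]
    note RD = nonneg_opD[OF Rn]
    have comm: "Q (R x) = R (Q x)" for x
      using Rcomm[OF bounded_clinear_bounded_linear[OF QD(1)]] QQ by metis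
    show "Q = R"
    proof
      fix x
      define y where "y = Q x - R x"
      have "inner (Q y) y + inner (R y) y = inner (Q y + R y) y" by (simp add: inner_add)
      also have "Q y + R y = 0"
        unfolding y_def by (simp add: linear_diff[OF QD(2)] linear_diff[OF RD(2)] comm QQ RR)
      finally have sum0: "inner (Q y) y + inner (R y) y = 0" by simp
      then have "inner (Q y) y = 0" "inner (R y) y = 0"
        using QD(4)[of y] RD(4)[of y] by linarith+
      then have "Q y = 0" "R y = 0"
        using semidefinite_form_zero[OF QD(2-4)] semidefinite_form_zero[OF RD(2-4)] by blast+
      moreover have "inner y y = inner x (Q y - R y)"
        unfolding y_def
        by (simp add: inner_diff QD(3) RD(3) linear_diff[OF QD(2)] linear_diff[OF RD(2)])
      ultimately show "Q x = R x" by (simp add: y_def)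
    qed
  qed
  with Rn RR show "nonneg_op (op_sqrt S)" and "op_sqrt S (op_sqrt S x) = S x" by simp_all
qed

lemma norm_op_sqrt:
  fixes S :: "'a::complex_hilbert \<Rightarrow> 'a"
  assumes "nonneg_op S"
  shows "(norm (op_sqrt S x))\<^sup>2 = inner (S x) x"
  using nonneg_opD(3)[OF nonneg_op_sqrt[OF assms], of "op_sqrt S x" x] op_sqrt_sqrt[OF assms]
  by (simp add: power2_norm_eq_inner)

lemma range_op_sqrt:
  fixes S :: "'a::complex_hilbert \<Rightarrow> 'a"
  assumes "nonneg_op S"
  shows "x \<in> range (op_sqrt S) \<longleftrightarrow> dominated (\<lambda>u. inner (S u) u) x"
  using in_range_iff_dominated[OF nonneg_opD(3,2)[OF nonneg_op_sqrt[OF assms]], of x]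
  unfolding norm_op_sqrt[OF assms] .

text \<open>Minimization over \<open>L\<close> with \<open>A\<close> the identity yields
  \<open>P x\<close>, which stays in \<open>L\<close> by closedness. It is the only point of
  \<open>L\<close> with the same inner products against \<open>L\<close> as \<open>x\<close>, whence
  linearity.\<close>

lemma orthogonal_projection_exists:
  fixes L :: "'a::complex_hilbert set"
  assumes L: "closed L" "subspace L" and Lc: "\<And>a x. x \<in> L \<Longrightarrow> scaleC a x \<in> L"
  obtains P where "bounded_clinear P" and "\<And>x y. inner (P x) y = inner x (P y)"
    and "\<And>x. norm (P x) \<le> norm x" and "\<And>x. P x \<in> L" and "\<And>x. x \<in> L \<Longrightarrow> P x = x"
proof -
  have "\<exists>p\<in>L. norm p \<le> norm x \<and> (\<forall>u\<in>L. inner x u = inner p u)" for x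
  proof -
    have "linear (inner x)" by (rule bounded_linear.linear[OF bounded_linear_inner_right])
    moreover have "\<bar>inner x u\<bar> \<le> norm x * norm (id u)" for u
      using Cauchy_Schwarz_ineq2[of x u] by simp
    ultimately obtain p where "p \<in> closure (id ` L)" and "norm p \<le> norm x"
      and "\<And>u. u \<in> L \<Longrightarrow> inner x u = inner p (id u)"
      using minimizer_exists[OF L(2) linear_id, of "inner x" "norm x"] norm_ge_zero by blast
    then show ?thesis using L(1) by auto
  qed
  then obtain P where PL: "\<And>x. P x \<in> L" and Pn: "\<And>x. norm (P x) \<le> norm x"
    and P: "\<And>x u. u \<in> L \<Longrightarrow> inner x u = inner (P x) u" by metis
  have uniq: "P x = p" if "p \<in> L" "\<And>u. u \<in> L \<Longrightarrow> inner x u = inner p u" for x p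
  proof -
    have "P x - p \<in> L" using PL that(1) L(2) by (simp add: subspace_diff)
    then have "inner (P x - p) (P x - p) = 0"
      using P[of "P x - p" x] that(2)[of "P x - p"] by (simp add: inner_diff_left)
    then show ?thesis by simp
  qed
  show thesis
  proof (rule that[of P])
    have "bounded_linear P"
    proof (rule bounded_linear_intro)
      show "P (x + y) = P x + P y" for x y
        by (rule uniq) (auto simp: inner_add_left PL L(2) subspace_add P[symmetric])
      show "P (r *\<^sub>R x) = r *\<^sub>R P x" for r x
        by (rule uniq) (auto simp: PL L(2) subspace_scale P[symmetric])
      show "norm (P x) \<le> norm x * 1" for x using Pn by simp
    qed
    moreover have "P (scaleC a x) = scaleC a (P x)" for a x
      by (rule uniq) (auto simp: PL Lc inner_scaleC_left P[symmetric])
    ultimately show "bounded_clinear P" by (simp add: bounded_clinear_def)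
    show "inner (P x) y = inner x (P y)" for x y
      by (metis P PL inner_commute)
    show "P x = x" if "x \<in> L" for x using that by (rule uniq) simp
  qed (rule Pn PL)+
qed

text \<open>The maximum is \<open>S\<^sup>1\<^sup>/\<^sup>2 P S\<^sup>1\<^sup>/\<^sup>2\<close>, with \<open>P\<close> the projection onto the preimage of \<open>K\<close> under \<open>S\<^sup>1\<^sup>/\<^sup>2\<close>.\<close>

lemma shorted_props:
  fixes S :: "'a::complex_hilbert \<Rightarrow> 'a"
  assumes S: "nonneg_op S" and K: "closed K" "subspace K" and Kc: "\<And>a x. x \<in> K \<Longrightarrow> scaleC a x \<in> K"
  shows nonneg_shorted: "nonneg_op (shorted S K)"
    and shorted_le: "inner (shorted S K x) x \<le> inner (S x) x"
    and dominated_shorted: "dominated (\<lambda>u. inner (shorted S K u) u) x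
      \<longleftrightarrow> x \<in> K \<and> dominated (\<lambda>u. inner (S u) u) x"
proof -
  define R where "R = op_sqrt S"
  have R: "nonneg_op R" unfolding R_def by (rule nonneg_op_sqrt[OF S])
  note RD = nonneg_opD[OF R]
  have RR: "(norm (R x))\<^sup>2 = inner (S x) x" for x
    unfolding R_def by (rule norm_op_sqrt[OF S])
  define L where "L = R -` K"
  have "closed L" unfolding L_def
    using bounded_clinear_bounded_linear[OF RD(1)] K(1)
    by (intro closed_vimage) (auto simp: linear_continuous_on)
  moreover have "subspace L" unfolding L_def
    using linear_subspace_vimage[OF RD(2) K(2)] .
  moreover have "scaleC a x \<in> L" if "x \<in> L" for a x
    using that RD(1) Kc unfolding L_def by (simp add: bounded_clinear_def)
  ultimately obtain P where P: "bounded_clinear P" and Psym: "\<And>x y. inner (P x) y = inner x (P y)"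
    and Pn: "\<And>x. norm (P x) \<le> norm x" and PL: "\<And>x. P x \<in> L" and Pid: "\<And>x. x \<in> L \<Longrightarrow> P x = x"
    using orthogonal_projection_exists by metis
  define Z where "Z = (\<lambda>x. R (P (R x)))"
  have Zform: "inner (Z x) x = (norm (P (R x)))\<^sup>2" for x
    unfolding Z_def RD(3) power2_norm_eq_inner by (metis PL Pid Psym)
  have Z: "nonneg_op Z"
    unfolding nonneg_op_iff
  proof (intro conjI allI)
    show "bounded_clinear Z" unfolding Z_def
      by (rule bounded_clinear_compose[OF RD(1) bounded_clinear_compose[OF P RD(1)]])
    show "inner (Z x) y = inner x (Z y)" for x y unfolding Z_def by (simp add: RD(3) Psym)
    show "0 \<le> inner (Z x) x" for x unfolding Zform by simp
  qed
  have ZS: "inner (Z x) x \<le> inner (S x) x" for x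
    unfolding Zform RR[symmetric] using Pn by (simp add: power_mono)
  then have ZleS: "le_op Z S" by (simp add: le_op_iff Z S)
  have ZK: "range Z \<subseteq> K" unfolding Z_def using PL by (auto simp: L_def)
  \<comment> \<open>Douglas' argument turns \<open>W \<le> S\<close> into \<open>W x = R v\<close>
    with \<open>norm v \<le> sqrt ?c\<close>. The range condition puts \<open>v\<close> into
    \<open>L\<close>, so in \<open>inner v (R x)\<close> only the projection \<open>P (R x)\<close>
    counts.\<close>
  have max: "le_op W Z" if W: "nonneg_op W" and WS: "le_op W S" and WK: "range W \<subseteq> K" for W
    unfolding le_op_iff[OF W Z]
  proof
    fix x
    note WD = nonneg_opD[OF W]
    let ?c = "inner (W x) x"
    have c: "?c \<ge> 0" by (rule WD(4))
    have "\<bar>inner (W x) u\<bar> \<le> sqrt ?c * norm (R u)" for u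
    proof -
      have "(inner (W x) u)\<^sup>2 \<le> ?c * inner (W u) u"
        by (rule semidefinite_Cauchy_Schwarz[OF WD(2-4)])
      also have "\<dots> \<le> ?c * (norm (R u))\<^sup>2"
        using WS c unfolding le_op_iff[OF W S] RR by (simp add: mult_left_mono)
      finally show ?thesis
        using real_sqrt_le_mono by (fastforce simp: real_sqrt_mult)
    qed
    moreover have "linear (inner (W x))"
      by (rule bounded_linear.linear[OF bounded_linear_inner_right])
    ultimately obtain v where vn: "norm v \<le> sqrt ?c" and v: "\<And>u. inner (W x) u = inner v (R u)"
      using minimizer_exists[OF subspace_UNIV RD(2), of "inner (W x)" "sqrt ?c"] c
      by (metis UNIV_I real_sqrt_ge_0_iff)
    have "W x = R v" using v by (metis RD(3) vector_eq_rdot)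
    then have "v \<in> L" using WK unfolding L_def by (metis range_subsetD vimageI2)
    then have "?c = inner v (P (R x))" using v Pid Psym by metis
    also have "\<dots> \<le> norm v * norm (P (R x))" by (rule norm_cauchy_schwarz)
    also have "\<dots> \<le> sqrt ?c * norm (P (R x))" using vn by (simp add: mult_right_mono)
    finally have "sqrt ?c * sqrt ?c \<le> sqrt ?c * norm (P (R x))" using c by simp
    then have "sqrt ?c \<le> norm (P (R x))"
      by (metis c mult_left_le_imp_le norm_ge_zero order_le_less real_sqrt_ge_zero)
    then show "?c \<le> inner (Z x) x" unfolding Zform by (rule sqrt_le_D)
  qed
  have eq: "shorted S K = Z" unfolding shorted_def
  proof (rule the_equality)
    show "(nonneg_op Z \<and> le_op Z S \<and> range Z \<subseteq> K) \<and>
      (\<forall>W. nonneg_op W \<and> le_op W S \<and> range W \<subseteq> K \<longrightarrow> le_op W Z)"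
      using Z ZleS ZK max by blast
    fix Z' assume "(nonneg_op Z' \<and> le_op Z' S \<and> range Z' \<subseteq> K) \<and>
      (\<forall>W. nonneg_op W \<and> le_op W S \<and> range W \<subseteq> K \<longrightarrow> le_op W Z')"
    then show "Z' = Z" using Z ZleS ZK max le_op_antisym by blast
  qed
  show "nonneg_op (shorted S K)" and "inner (shorted S K x) x \<le> inner (S x) x"
    unfolding eq by (rule Z ZS)+
  \<comment> \<open>The adjoint \<open>P R\<close> of \<open>R P\<close> gives the form of
    \<open>Z\<close> as its squared norm, so that form describes the range of \<open>R P\<close>,
    which is \<open>R (L) = ran R \<inter> K\<close>.\<close>
  have "x \<in> range (\<lambda>a. R (P a)) \<longleftrightarrow> dominated (\<lambda>u. (norm (P (R u)))\<^sup>2) x" for x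
    by (rule in_range_iff_dominated[OF _
          bounded_clinear_linear[OF bounded_clinear_compose[OF P RD(1)]]])
      (simp add: RD(3) Psym)
  moreover have "x \<in> range R \<longleftrightarrow> dominated (\<lambda>u. inner (S u) u) x" for x
    unfolding R_def by (rule range_op_sqrt[OF S])
  moreover have "x \<in> range (\<lambda>a. R (P a)) \<longleftrightarrow> x \<in> K \<and> x \<in> range R" for x
  proof
    assume "x \<in> range (\<lambda>a. R (P a))"
    then show "x \<in> K \<and> x \<in> range R" using PL unfolding L_def by auto
  next
    assume "x \<in> K \<and> x \<in> range R"
    then obtain v where "x = R v" "v \<in> L" unfolding L_def by auto
    then show "x \<in> range (\<lambda>a. R (P a))" using Pid by (metis rangeI)
  qed
  ultimately show "dominated (\<lambda>u. inner (shorted S K u) u) x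
      \<longleftrightarrow> x \<in> K \<and> dominated (\<lambda>u. inner (S u) u) x"
    unfolding eq Zform by blast
qed

lemma fst_space_props:
  shows "closed (fst_space :: ('h::complex_hilbert \<times> 'm::complex_hilbert) set)"
    and "subspace (fst_space :: ('h \<times> 'm) set)"
    and "x \<in> (fst_space :: ('h \<times> 'm) set) \<Longrightarrow> scaleC a x \<in> fst_space"
proof -
  show "closed (fst_space :: ('h \<times> 'm) set)"
    unfolding fst_space_def by (intro closed_Times) auto
  show "subspace (fst_space :: ('h \<times> 'm) set)"
    unfolding fst_space_def subspace_def by (auto simp: zero_prod_def)
  have "scaleC a 0 = (0::'m)"
    by (metis add_cancel_right_right scaleC_add_right)
  then show "x \<in> (fst_space :: ('h \<times> 'm) set) \<Longrightarrow> scaleC a x \<in> fst_space"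
    unfolding fst_space_def by (auto simp: scaleC_prod_def)
qed

text \<open>Shorting intersects the range of the root with the subspace; on vectors
  \<open>(h, 0)\<close> the shorted operator thus drops out of the criterion.\<close>

lemma ran_sqrt_shorted_iff:
  fixes S :: "'h::complex_hilbert \<times> 'm::complex_hilbert \<Rightarrow> 'h \<times> 'm"
  assumes "nonneg_op S"
  shows "h \<in> ran_sqrt_shorted S \<longleftrightarrow> dominated (\<lambda>u. inner (S u) u) (h, 0)"
proof -
  have "p \<in> range (op_sqrt (shorted S fst_space))
      \<longleftrightarrow> p \<in> fst_space \<and> dominated (\<lambda>u. inner (S u) u) p" for p
    using range_op_sqrt[OF nonneg_shorted[OF assms fst_space_props]]
      dominated_shorted[OF assms fst_space_props] by blast
  then show ?thesis
    unfolding ran_sqrt_shorted_def image_iff Bex_def by (auto simp: fst_space_def)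
qed

section \<open>Contractions and defect operators\<close>

lemma contractionD:
  assumes "contraction T"
  shows "bounded_clinear T" and "norm (T x) \<le> norm x"
  using assms by (simp_all add: contraction_def)

lemma contraction_cadj:
  fixes T :: "'a::complex_hilbert \<Rightarrow> 'b::complex_inner"
  assumes T: "contraction T"
  shows "contraction (cadj T)"
proof -
  note TD = contractionD[OF T]
  have "norm (cadj T y) \<le> norm y" for y
  proof -
    have "norm (cadj T y) * norm (cadj T y) = inner (T (cadj T y)) y"
      by (simp add: inner_cadj[OF TD(1)] power2_norm_eq_inner[symmetric] power2_eq_square)
    also have "\<dots> \<le> norm (T (cadj T y)) * norm y" by (rule norm_cauchy_schwarz)
    also have "\<dots> \<le> norm (cadj T y) * norm y" using TD(2) by (intro mult_right_mono) auto
    finally show ?thesis by (cases "cadj T y = 0") (simp_all add: mult_le_cancel_left)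
  qed
  then show ?thesis using bounded_clinear_cadj[OF TD(1)] by (simp add: contraction_def)
qed

lemma defect_props:
  fixes T :: "'a::complex_hilbert \<Rightarrow> 'b::complex_inner"
  assumes T: "contraction T"
  shows nonneg_defect: "nonneg_op (defect T)"
    and nonneg_defect_sq: "nonneg_op (defect T ^^ 2)"
    and defect_sq: "(defect T ^^ 2) x = x - cadj T (T x)"
    and defect_sq_form: "inner ((defect T ^^ 2) x) x = (norm x)\<^sup>2 - (norm (T x))\<^sup>2"
    and norm_defect: "(norm (defect T x))\<^sup>2 = (norm x)\<^sup>2 - (norm (T x))\<^sup>2"
proof -
  note TD = contractionD[OF T]
  let ?S = "\<lambda>x. x - cadj T (T x)"
  have form: "inner (?S x) x = (norm x)\<^sup>2 - (norm (T x))\<^sup>2" for x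
    using inner_cadj[OF TD(1), of x "T x"]
    by (simp add: inner_diff power2_norm_eq_inner inner_commute)
  have S: "nonneg_op ?S"
    unfolding nonneg_op_iff
  proof (intro conjI allI)
    show "bounded_clinear ?S"
      by (intro bounded_clinear_diff bounded_clinear_ident
          bounded_clinear_compose[OF bounded_clinear_cadj[OF TD(1)] TD(1)])
    show "inner (?S x) y = inner x (?S y)" for x y
      using inner_cadj[OF TD(1), of x "T y"] inner_cadj[OF TD(1), of y "T x"]
      by (simp add: inner_diff inner_commute)
    show "0 \<le> inner (?S x) x" for x unfolding form using TD(2)[of x] by (simp add: power_mono)
  qed
  have two: "defect T ^^ 2 = ?S"
    unfolding defect_def by (rule ext) (simp add: numeral_2_eq_2 op_sqrt_sqrt[OF S])
  show "nonneg_op (defect T)" unfolding defect_def by (rule nonneg_op_sqrt[OF S])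
  show "nonneg_op (defect T ^^ 2)" and "(defect T ^^ 2) x = x - cadj T (T x)"
    and "inner ((defect T ^^ 2) x) x = (norm x)\<^sup>2 - (norm (T x))\<^sup>2"
    using S form by (simp_all add: two)
  show "(norm (defect T x))\<^sup>2 = (norm x)\<^sup>2 - (norm (T x))\<^sup>2"
    unfolding defect_def norm_op_sqrt[OF S] by (rule form)
qed

text \<open>For a contraction this is the form of \<open>D_T^2\<close>, so domination by it means
  membership in \<open>ran D_T\<close>.\<close>

abbreviation defect_form :: "('a::real_normed_vector \<Rightarrow> 'b::real_normed_vector) \<Rightarrow> 'a \<Rightarrow> real"
  where "defect_form T u \<equiv> (norm u)\<^sup>2 - (norm (T u))\<^sup>2"

text \<open>For a contraction this is the intertwining relation between \<open>T D_T\<close> and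
  \<open>D_{T*} T\<close> read on ranges: \<open>T\<close> maps \<open>ran D_T\<close> into
  \<open>ran D_{T*}\<close>. Any adjoint pair is allowed, so it serves both \<open>T\<close> and
  \<open>cadj T\<close>.\<close>

lemma dominated_defect_form_adjoint:
  fixes T :: "'a::real_inner \<Rightarrow> 'b::real_inner"
  assumes adj: "\<And>u v. inner (T u) v = inner u (T' v)" and x: "dominated (defect_form T) x"
  shows "dominated (defect_form T') (T x)"
proof -
  obtain c where c: "c \<ge> 0" and cx: "\<And>u. (inner x u)\<^sup>2 \<le> c * defect_form T u"
    using x unfolding dominated_def by blast
  have "(inner (T x) v)\<^sup>2 \<le> c * defect_form T' v" for v
  proof -
    have "0 \<le> (norm (v - T (T' v)))\<^sup>2" by simp
    also have "\<dots> = defect_form T' v - defect_form T (T' v)"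
      using adj[of "T' v" v] by (simp add: power2_norm_eq_inner inner_diff inner_commute)
    finally have "c * defect_form T (T' v) \<le> c * defect_form T' v"
      using c by (simp add: mult_left_mono)
    then show ?thesis using cx[of "T' v"] by (simp add: adj)
  qed
  with c show ?thesis by (rule dominatedI)
qed

lemma norm_sq_prod: "(norm p)\<^sup>2 = (norm (fst p))\<^sup>2 + (norm (snd p))\<^sup>2"
  by (simp add: norm_prod_def)

lemma inner_Pair_zero: "inner (x, 0) u = inner x (fst u)" "inner u (x, 0) = inner (fst u) x"
  by (simp_all add: inner_prod_def)

lemma scaleC_zero_right: "scaleC a 0 = 0"
  using scaleC_diff_right[of a 0 0] by simp

lemma bounded_clinear_proj_snd:
  "bounded_clinear (proj_snd :: 'h::complex_inner \<times> 'm::complex_inner \<Rightarrow> _)"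
  unfolding bounded_clinear_def proj_snd_def
  by (auto intro!: bounded_linear_Pair bounded_linear_zero bounded_linear_snd
      simp: scaleC_prod_def scaleC_zero_right)

lemma contraction_proj_snd_comp:
  fixes T :: "'a::complex_inner \<Rightarrow> 'h::complex_inner \<times> 'n::complex_inner"
  assumes "contraction T"
  shows "contraction (proj_snd \<circ> T)"
proof -
  note TD = contractionD[OF assms]
  have "norm (proj_snd p) \<le> norm p" for p :: "'h \<times> 'n"
    by (rule power2_le_imp_le) (simp_all add: norm_sq_prod proj_snd_def)
  then show ?thesis
    unfolding contraction_def comp_def
    using bounded_clinear_compose[OF bounded_clinear_proj_snd TD(1)] TD(2) by (meson order_trans)
qed

lemma bounded_clinear_after_proj_fst:
  assumes "bounded_clinear Y"
  shows "bounded_clinear (after_proj_fst Y :: 'h::complex_inner \<times> 'm::complex_inner \<Rightarrow> _)"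
proof -
  have "bounded_linear (after_proj_fst Y :: 'h \<times> 'm \<Rightarrow> _)"
    using bounded_linear_Pair[OF bounded_linear_compose[OF bounded_clinear_bounded_linear[OF assms]
        bounded_linear_fst] bounded_linear_zero]
    unfolding after_proj_fst_def[abs_def] .
  with assms show ?thesis
    by (simp add: bounded_clinear_def after_proj_fst_def scaleC_prod_def scaleC_zero_right)
qed

lemma after_proj_fst_zero: "after_proj_fst (\<lambda>h. 0) = (\<lambda>p. 0)"
  by (simp add: after_proj_fst_def fun_eq_iff zero_prod_def)

section \<open>The Riccati equation\<close>

text \<open>Everything is phrased by forms: \<open>YT\<close> expresses that \<open>Y P\<close> is
  below the operator shorted in the equation, \<open>zero\<close> that \<open>D_T^2\<close> shorts
  to zero, and \<open>incl\<close> is the range hypothesis.\<close>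

lemma nonneg_op_eq_zero_of_le_riccati_form:
  fixes T :: "'h::complex_hilbert \<times> 'm::complex_hilbert \<Rightarrow> 'h \<times> 'n::complex_hilbert"
  assumes T: "contraction T" and Y: "nonneg_op Y" and Y1: "\<And>h. inner (Y h) h \<le> (norm h)\<^sup>2"
    and YT: "\<And>p. inner (Y (fst p)) (fst p) \<le> defect_form T p + inner (Y (fst (T p))) (fst (T p))"
    and zero: "\<And>h. dominated (defect_form T) (h, 0) \<Longrightarrow> h = 0"
    and incl: "\<And>h. dominated (defect_form (proj_snd \<circ> T)) (h, 0) \<Longrightarrow>
      dominated (defect_form (proj_snd \<circ> cadj T)) (h, 0) \<Longrightarrow> dominated (defect_form (cadj T)) (h, 0)"
  shows "Y h = 0"
proof -
  note Tb = contractionD(1)[OF T]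
  note T'b = bounded_clinear_cadj[OF Tb]
  note adj = inner_cadj[OF Tb]
  have adj': "inner (cadj T y) x = inner y (T x)" for x y
    using adj[of x y] by (simp add: inner_commute)
  define Q where "Q = op_sqrt Y"
  have Q: "nonneg_op Q" unfolding Q_def by (rule nonneg_op_sqrt[OF Y])
  note QD = nonneg_opD[OF Q]
  have QY: "(norm (Q h))\<^sup>2 = inner (Y h) h" for h unfolding Q_def by (rule norm_op_sqrt[OF Y])
  define E where "E = defect T"
  have E: "nonneg_op E" unfolding E_def by (rule nonneg_defect[OF T])
  note ED = nonneg_opD[OF E]
  have EE: "(norm (E x))\<^sup>2 = defect_form T x" for x unfolding E_def by (rule norm_defect[OF T])
  have ran_E: "dominated (defect_form T) (E a)" for a
    using in_range_iff_dominated[OF ED(3,2), of "E a"] unfolding EE by simp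
  \<comment> \<open>The form of the operator \<open>S\<close> shorted in the equation; domination by
    it means membership in the range of the root of \<open>S\<close>.\<close>
  define q where "q p = defect_form T p + (norm (Q (fst (T p))))\<^sup>2" for p
  have Q_dom: "dominated q (Q b, 0)" for b
  proof (rule dominatedI[of "(norm b)\<^sup>2"])
    fix u :: "'h \<times> 'm"
    have "(inner (Q b, 0) u)\<^sup>2 = (inner b (Q (fst u)))\<^sup>2" by (simp add: inner_prod_def QD(3))
    also have "\<dots> \<le> (norm b)\<^sup>2 * (norm (Q (fst u)))\<^sup>2"
      by (metis Cauchy_Schwarz_ineq power2_norm_eq_inner)
    also have "\<dots> \<le> (norm b)\<^sup>2 * q u"
      unfolding q_def QY by (intro mult_left_mono YT) simp
    finally show "(inner (Q b, 0) u)\<^sup>2 \<le> (norm b)\<^sup>2 * q u" .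
  qed simp
  have "Q b0 = 0" for b0
  proof -
    define y where "y = Q b0"
    \<comment> \<open>A row operator with \<open>V V* = S\<close>, so it has the range of the root
      of \<open>S\<close>, and membership of \<open>(y, 0)\<close> yields explicit \<open>a\<close>
      and \<open>b\<close>.\<close>
    define V where "V = (\<lambda>(a, b). E a + cadj T (Q b, 0))"
    define V' where "V' u = (E u, Q (fst (T u)))" for u
    have V'V: "inner (V p) u = inner p (V' u)" for p u
      unfolding V_def V'_def by (cases p) (simp add: inner_add_left adj' ED(3) QD(3) inner_Pair_zero)
    have V'lin: "linear V'" unfolding V'_def
      using bounded_linear_Pair[OF bounded_clinear_bounded_linear[OF ED(1)]
          bounded_linear_compose[OF bounded_clinear_bounded_linear[OF QD(1)]
          bounded_linear_compose[OF bounded_linear_fst bounded_clinear_bounded_linear[OF Tb]]]]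
      by (rule bounded_linear.linear)
    have "(\<lambda>u. (norm (V' u))\<^sup>2) = q"
      by (rule ext) (simp add: norm_Pair V'_def q_def EE[symmetric])
    then have "(y, 0) \<in> range V"
      using in_range_iff_dominated[OF V'V V'lin, of "(y, 0)"] Q_dom[of b0] by (simp add: y_def)
    then obtain a b where yab: "(y, 0) = E a + cadj T (Q b, 0)" unfolding V_def by auto
    define z where "z = Q b"
    have "dominated (defect_form (proj_snd \<circ> T)) (z, 0)"
    proof (rule dominated_mono[of q])
      show "dominated q (z, 0)" unfolding z_def by (rule Q_dom)
      \<comment> \<open>As \<open>Y \<le> I\<close>, the last term of \<open>q u\<close> is at most
        the first component's share of \<open>(norm (T u))^2\<close>, which leaves that of
        \<open>snd (T u)\<close>.\<close>
      show "q u \<le> defect_form (proj_snd \<circ> T) u" for u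
        using Y1[of "fst (T u)"] unfolding q_def QY by (simp add: norm_sq_prod[of "T u"] proj_snd_def)
    qed
    moreover have "dominated (defect_form (proj_snd \<circ> cadj T)) (z, 0)"
    proof -
      have le: "defect_form (cadj T) u \<le> defect_form (proj_snd \<circ> cadj T) u" for u
        by (simp add: norm_sq_prod[of "cadj T u"] proj_snd_def)
      \<comment> \<open>Only the first component of \<open>cadj T u\<close> meets
        \<open>(y, 0)\<close>, and contractivity bounds its squared norm by this defect
        form.\<close>
      have "dominated (defect_form (proj_snd \<circ> cadj T)) (T (y, 0))"
      proof (rule dominatedI[of "(norm y)\<^sup>2"])
        fix u
        have "(inner (T (y, 0)) u)\<^sup>2 = (inner y (fst (cadj T u)))\<^sup>2" by (simp add: adj inner_Pair_zero)
        also have "\<dots> \<le> (norm y)\<^sup>2 * (norm (fst (cadj T u)))\<^sup>2"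
          by (metis Cauchy_Schwarz_ineq power2_norm_eq_inner)
        also have "\<dots> \<le> (norm y)\<^sup>2 * defect_form (proj_snd \<circ> cadj T) u"
          using power_mono[OF contractionD(2)[OF contraction_cadj[OF T], of u], of 2]
          by (intro mult_left_mono) (simp_all add: norm_sq_prod[of "cadj T u"] proj_snd_def)
        finally show "(inner (T (y, 0)) u)\<^sup>2
          \<le> (norm y)\<^sup>2 * defect_form (proj_snd \<circ> cadj T) u" .
      qed simp
      moreover have "dominated (defect_form (cadj T)) (T (E (- a)))"
        by (rule dominated_defect_form_adjoint[OF adj ran_E])
      \<comment> \<open>\<open>I - T T*\<close> is the squared defect operator of \<open>T*\<close>;
        Cauchy-Schwarz for its form shows that the form dominates its values.\<close>
      moreover have "dominated (defect_form (cadj T)) ((z, 0) - T (cadj T (z, 0)))"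
      proof -
        note c' = contraction_cadj[OF T]
        note D = nonneg_opD[OF nonneg_defect_sq[OF c']]
        have TT: "cadj (cadj T) = T"
          using inner_cadj[OF T'b] adj' by (intro ext) (metis vector_eq_ldot)
        have "dominated (defect_form (cadj T)) ((defect (cadj T) ^^ 2) w)" for w
        proof (rule dominatedI[of "inner ((defect (cadj T) ^^ 2) w) w"])
          show "(inner ((defect (cadj T) ^^ 2) w) u)\<^sup>2
            \<le> inner ((defect (cadj T) ^^ 2) w) w * defect_form (cadj T) u" for u
            using semidefinite_Cauchy_Schwarz[OF D(2-4), of w u] unfolding defect_sq_form[OF c'] .
        qed (rule D(4))
        from this[of "(z, 0)"] show ?thesis by (simp add: defect_sq[OF c'] TT)
      qed
      ultimately have "dominated (defect_form (proj_snd \<circ> cadj T))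
          (T (y, 0) + T (E (- a)) + ((z, 0) - T (cadj T (z, 0))))"
        using dominated_mono[OF _ le] by (intro dominated_add) auto
      \<comment> \<open>\<open>T\<close> applied to \<open>yab\<close> makes the first two terms
        equal to \<open>T (cadj T (z, 0))\<close>, which cancels.\<close>
      moreover have "T (y, 0) + T (E (- a)) + ((z, 0) - T (cadj T (z, 0))) = (z, 0)"
        unfolding yab z_def
        by (simp add: linear_add[OF bounded_clinear_linear[OF Tb]]
            linear_neg[OF bounded_clinear_linear[OF Tb]] linear_neg[OF ED(2)])
      ultimately show ?thesis by simp
    qed
    ultimately have "dominated (defect_form (cadj T)) (z, 0)" by (rule incl)
    \<comment> \<open>The intertwining again, with \<open>T\<close> and \<open>cadj T\<close>
      exchanged.\<close>
    then have "dominated (defect_form T) (cadj T (z, 0))"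
      by (rule dominated_defect_form_adjoint[OF adj'])
    with ran_E[of a] have "dominated (defect_form T) (y, 0)"
      unfolding yab z_def by (rule dominated_add)
    then show ?thesis using zero y_def by simp
  qed
  then show ?thesis using op_sqrt_sqrt[OF Y, of h] by (simp add: Q_def)
qed

theorem theorem7p10:
  fixes A :: "'h::complex_hilbert \<Rightarrow> 'h"
    and B :: "'m::complex_hilbert \<Rightarrow> 'h"
    and C :: "'h \<Rightarrow> 'n::complex_hilbert"
    and D :: "'m \<Rightarrow> 'n"
    and T :: "'h \<times> 'm \<Rightarrow> 'h \<times> 'n"
  assumes "bounded_clinear A" and "bounded_clinear B"
    and "bounded_clinear C" and "bounded_clinear D"
    and "T = block_op A B C D"
    and "contraction T"
    and "shorted (defect T ^^ 2) fst_space = (\<lambda>p. 0)"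
    and "ran_sqrt_shorted (defect (proj_snd \<circ> T) ^^ 2)
           \<inter> ran_sqrt_shorted (defect (proj_snd \<circ> cadj T) ^^ 2)
         \<subseteq> ran_sqrt_shorted (defect (cadj T) ^^ 2)"
  shows "\<forall>X. pos_contraction X \<and> riccati T X \<longleftrightarrow> X = id"
proof (intro allI iffI)
  note T = assms(6)
  note Tb = contractionD(1)[OF T]
  note T'b = bounded_clinear_cadj[OF Tb]
  note adj = inner_cadj[OF Tb]
  have adj': "inner (cadj T y) x = inner y (T x)" for x y
    using adj[of x y] by (simp add: inner_commute)
  {
    fix X :: "'h \<Rightarrow> 'h" assume X: "X = id"
    have "nonneg_op (id :: 'h \<Rightarrow> 'h)" unfolding nonneg_op_iff id_def
      by (simp add: bounded_clinear_ident)
    then have "pos_contraction X"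
      unfolding X pos_contraction_def contraction_def by (auto simp: nonneg_opD(1))
    \<comment> \<open>For \<open>X = id\<close> the left side is zero and the operator to be shorted
      is \<open>D_T^2\<close>, which shorts to zero by hypothesis.\<close>
    moreover have "riccati T X"
    proof -
      have "cadj T 0 = 0" by (rule linear_0[OF bounded_clinear_linear[OF T'b]])
      then show ?thesis
        unfolding riccati_def X using assms(7) by (simp add: after_proj_fst_zero)
    qed
    ultimately show "pos_contraction X \<and> riccati T X" ..
  }
  fix X assume "pos_contraction X \<and> riccati T X"
  then have X: "nonneg_op X" and Xc: "contraction X" and ric: "riccati T X"
    by (auto simp: pos_contraction_def)
  note XD = nonneg_opD[OF X]
  define Y where "Y = (\<lambda>h. h - X h)"
  have Y: "nonneg_op Y" unfolding nonneg_op_iff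
  proof (intro conjI allI)
    show "bounded_clinear Y" unfolding Y_def by (intro bounded_clinear_diff bounded_clinear_ident XD(1))
    show "inner (Y x) y = inner x (Y y)" for x y unfolding Y_def by (simp add: inner_diff XD(3))
    fix x
    have "inner (X x) x \<le> norm (X x) * norm x" by (rule norm_cauchy_schwarz)
    also have "\<dots> \<le> norm x * norm x" using contractionD(2)[OF Xc] by (intro mult_right_mono) auto
    finally show "0 \<le> inner (Y x) x"
      unfolding Y_def by (simp add: inner_diff power2_norm_eq_inner[symmetric] power2_eq_square)
  qed
  note YD = nonneg_opD[OF Y]
  define S where "S p = (defect T ^^ 2) p + cadj T (after_proj_fst Y (T p))" for p
  note D2 = nonneg_opD[OF nonneg_defect_sq[OF T]]
  have Sform: "inner (S p) p = defect_form T p + inner (Y (fst (T p))) (fst (T p))" for p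
    unfolding S_def
    by (simp add: inner_add_left defect_sq_form[OF T] adj' after_proj_fst_def inner_Pair_zero)
  have S: "nonneg_op S" unfolding nonneg_op_iff
  proof (intro conjI allI)
    show "bounded_clinear S" unfolding S_def
      by (rule bounded_clinear_add[OF D2(1) bounded_clinear_compose[OF T'b
          bounded_clinear_compose[OF bounded_clinear_after_proj_fst[OF YD(1)] Tb]]])
    show "inner (S p) r = inner p (S r)" for p r
      unfolding S_def
      by (simp add: inner_add_left inner_add_right D2(3) YD(3) adj' adj[symmetric]
          after_proj_fst_def inner_Pair_zero)
    show "0 \<le> inner (S p) p" for p
      unfolding Sform using contractionD(2)[OF T, of p] YD(4) by (simp add: power_mono)
  qed
  have short: "shorted S fst_space = after_proj_fst Y"
    using ric unfolding riccati_def S_def[abs_def] Y_def by simp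
  have "Y h = 0" for h
  proof (rule nonneg_op_eq_zero_of_le_riccati_form[OF T Y])
    show "inner (Y h) h \<le> (norm h)\<^sup>2" for h
      using XD(4)[of h] unfolding Y_def by (simp add: inner_diff power2_norm_eq_inner)
    \<comment> \<open>The shorted operator is at most \<open>S\<close>, and by the equation it is
      \<open>Y P\<close>.\<close>
    show "inner (Y (fst p)) (fst p) \<le> defect_form T p + inner (Y (fst (T p))) (fst (T p))" for p
      using shorted_le[OF S fst_space_props, of p] unfolding short Sform
      by (simp add: after_proj_fst_def inner_prod_def)
    \<comment> \<open>As \<open>(h, 0)\<close> lies in \<open>fst_space\<close>, domination passes
      to the form of the shorted operator. That form is zero, so \<open>(h, 0)\<close> is orthogonal
      to itself.\<close>
    show "h = 0" if "dominated (defect_form T) (h, 0)" for h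
    proof -
      have "dominated (\<lambda>u. inner (shorted (defect T ^^ 2) fst_space u) u) (h, 0)"
        using that dominated_shorted[OF nonneg_defect_sq[OF T] fst_space_props, of "(h, 0)"]
        unfolding defect_sq_form[OF T] by (simp add: fst_space_def)
      then have "(inner (h, 0) (h, 0 :: 'm))\<^sup>2 \<le> 0"
        unfolding assms(7) dominated_def by (metis inner_zero_left mult_zero_right)
      then show ?thesis by (simp add: inner_prod_def)
    qed
    note c = contraction_cadj[OF T]
    note N = contraction_proj_snd_comp[OF T] and M = contraction_proj_snd_comp[OF c]
    show "dominated (defect_form (cadj T)) (h, 0)"
      if "dominated (defect_form (proj_snd \<circ> T)) (h, 0)"
        and "dominated (defect_form (proj_snd \<circ> cadj T)) (h, 0)" for h
      using that assms(8)
        ran_sqrt_shorted_iff[OF nonneg_defect_sq[OF N], of h, unfolded defect_sq_form[OF N]]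
        ran_sqrt_shorted_iff[OF nonneg_defect_sq[OF M], of h, unfolded defect_sq_form[OF M]]
        ran_sqrt_shorted_iff[OF nonneg_defect_sq[OF c], of h, unfolded defect_sq_form[OF c]]
      by blast
  qed
  then show "X = id" unfolding Y_def by (intro ext) simp
qed

end
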